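(* Let $F$ be a distribution on $[0,\infty)$ with $F(0)<\vec{p}_c$. Then there exist $\delta=\delta(F)>0$ and constants $C_1,C_2>0$ (depending on $F,\delta$) such that for all $r>0$ and all $0\leq\theta\leq\pi/2$, $${\bf P}[\vec{T}({\bf 0},(r,\theta))\leq\delta r]\leq C_1\exp(-C_2 r).$$
   Context: Directed first passage percolation on ${\bf Z}^2$: i.i.d. non-negative passage times $t(e)$ with distribution $F$ on the nearest-neighbour edges of ${\bf Z}^2$. A northeast (NE) path moves only by steps $(1,0)$ or $(0,1)$. $\vec{T}(u,v)=\inf\sum_{e\in\gamma}t(e)$ over NE paths $\gamma$ from $u$ to $v$; for $u\in{\bf R}^2$, $\vec T({\bf 0},u)=\vec T({\bf 0},u')$ with $u'$ the nearest vertex of ${\bf Z}^2$ (ties broken by a fixed order). Points are in polar coordinates $(r,\theta)\in{\bf R}^+\times[0,\pi/2]$. $\vec{p}_c$ denotes the critical probability of oriented bond percolation on ${\bf Z}^2$ with NE-oriented edges. *)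

theory Defs
  imports "HOL-Probability.Probability"
begin

text \<open>Vertices of Z^2 and NE-oriented nearest-neighbour edges.
  An edge is encoded by its lower/left endpoint v and a direction flag:
  (v, True) is the edge from v to v + (1,0), (v, False) the edge from v to v + (0,1).\<close>

type_synonym vertex = "int \<times> int"
type_synonym edge = "vertex \<times> bool"

definition step :: "vertex \<Rightarrow> bool \<Rightarrow> vertex" where
  "step v d = (if d then (fst v + 1, snd v) else (fst v, snd v + 1))"

fun endpoint :: "vertex \<Rightarrow> bool list \<Rightarrow> vertex" where
  "endpoint u [] = u"
| "endpoint u (d # ds) = endpoint (step u d) ds"

fun path_edges :: "vertex \<Rightarrow> bool list \<Rightarrow> edge list" where
  "path_edges u [] = []"
| "path_edges u (d # ds) = (u, d) # path_edges (step u d) ds"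

definition path_time :: "(edge \<Rightarrow> real) \<Rightarrow> vertex \<Rightarrow> bool list \<Rightarrow> real" where
  "path_time \<omega> u ss = (\<Sum>e\<leftarrow>path_edges u ss. \<omega> e)"

definition dir_T :: "(edge \<Rightarrow> real) \<Rightarrow> vertex \<Rightarrow> vertex \<Rightarrow> real" where
  "dir_T \<omega> u v = (INF ss\<in>{ss. endpoint u ss = v}. path_time \<omega> u ss)"

text \<open>Nearest vertex of Z^2 to a point of R^2 (componentwise rounding;
  ties broken upward, a fixed rule) and the point with polar coordinates (r,theta).\<close>
definition nearest_vertex :: "real \<times> real \<Rightarrow> vertex" where
  "nearest_vertex x = (round (fst x), round (snd x))"

definition polar :: "real \<Rightarrow> real \<Rightarrow> real \<times> real" where
  "polar r \<theta> = (r * cos \<theta>, r * sin \<theta>)"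

definition fpp_space :: "real measure \<Rightarrow> (edge \<Rightarrow> real) measure" where
  "fpp_space F = (\<Pi>\<^sub>M e\<in>(UNIV::edge set). F)"

definition perc_space :: "real \<Rightarrow> (edge \<Rightarrow> bool) measure" where
  "perc_space p = (\<Pi>\<^sub>M e\<in>(UNIV::edge set). measure_pmf (bernoulli_pmf p))"

text \<open>The oriented cluster of the origin is infinite iff there are open NE paths
  from the origin of every length (finite degree).\<close>
definition percolates :: "(edge \<Rightarrow> bool) \<Rightarrow> bool" where
  "percolates \<omega> \<longleftrightarrow> (\<forall>n. \<exists>ss. length ss = n \<and> (\<forall>e\<in>set (path_edges (0,0) ss). \<omega> e))"

definition perc_prob :: "real \<Rightarrow> real" where
  "perc_prob p = measure (perc_space p) {\<omega>\<in>space (perc_space p). percolates \<omega>}"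

definition oriented_pc :: real where
  "oriented_pc = Sup {p\<in>{0..1}. perc_prob p = 0}"

end

theory Submission
  imports Defs
begin

text \<open>
  Call an edge open if its passage time is at most \<open>\<epsilon>\<close>; for small \<open>\<epsilon>\<close> the density \<open>q\<close> of open edges
  is still below some \<open>p\<close> without oriented percolation. The argument of Duminil-Copin and Tassion
  applies: if for every finite \<open>S\<close> containing the origin the expected number of edges through which
  an open path inside \<open>S\<close> can leave \<open>S\<close> were at least 1 at density \<open>q\<close>, then Russo's formula would
  give \<open>\<theta>\<^sub>n' \<ge> 1 - \<theta>\<^sub>n\<close> on \<open>[q, p]\<close> for the probability \<open>\<theta>\<^sub>n\<close> of an open path of length \<open>n\<close>, and
  \<open>p\<close> would percolate. So this number is less than 1 for some \<open>S\<close>. A path with at most \<open>c\<close>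
  closed edges either leaves \<open>S\<close> with its budget \<open>c\<close> intact or with at most \<open>c - 1\<close>; iterating, such a
  path of length \<open>N\<close> exists with probability at most \<open>\<rho>\<^sup>k K\<^sup>c\<close>, where \<open>\<rho> < 1\<close> and \<open>k\<close> is proportional
  to \<open>N\<close>, which is exponentially small when \<open>c\<close> is a small multiple of \<open>N\<close>.
\<close>

section \<open>Finite Bernoulli expectations\<close>

text \<open>This is the expectation of \<open>f\<close> over a random subset of \<open>E\<close>
  that contains each element independently with probability \<open>p\<close>. For finite
  \<open>E\<close> it is a polynomial in \<open>p\<close>, so it can be differentiated and treated
  by induction on \<open>E\<close> without measure theory.\<close>

definition bern_exp :: "real \<Rightarrow> 'a set \<Rightarrow> ('a set \<Rightarrow> real) \<Rightarrow> real" where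
  "bern_exp p E f = (\<Sum>A\<in>Pow E. p ^ card A * (1 - p) ^ card (E - A) * f A)"

lemma bern_exp_empty [simp]: "bern_exp p {} f = f {}"
  by (simp add: bern_exp_def)

text \<open>Conditioning on the state of \<open>e\<close>. This recursion drives most of the
  inductions over \<open>E\<close> below.\<close>

lemma bern_exp_insert:
  assumes "finite E" "e \<notin> E"
  shows "bern_exp p (insert e E) f
       = p * bern_exp p E (\<lambda>A. f (insert e A)) + (1 - p) * bern_exp p E f"
proof -
  have 1: "Pow E \<inter> insert e ` Pow E = {}" "inj_on (insert e) (Pow E)"
    using assms(2) by (auto simp: inj_on_def)
  have 2: "p ^ card (insert e A) * (1 - p) ^ card (insert e E - insert e A) * f (insert e A)
      = p * (p ^ card A * (1 - p) ^ card (E - A) * f (insert e A))"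
    and 3: "p ^ card A * (1 - p) ^ card (insert e E - A) * f A
      = (1 - p) * (p ^ card A * (1 - p) ^ card (E - A) * f A)" if "A \<in> Pow E" for A
  proof -
    have fA: "finite A" and eA: "e \<notin> A" using that assms finite_subset by auto
    have *: "insert e E - insert e A = E - A" "insert e E - A = insert e (E - A)"
      using assms eA by auto
    show "p ^ card (insert e A) * (1 - p) ^ card (insert e E - insert e A) * f (insert e A)
      = p * (p ^ card A * (1 - p) ^ card (E - A) * f (insert e A))"
      unfolding * using fA eA by simp
    show "p ^ card A * (1 - p) ^ card (insert e E - A) * f A
      = (1 - p) * (p ^ card A * (1 - p) ^ card (E - A) * f A)"
      unfolding * using assms by simp
  qed
  have "bern_exp p (insert e E) f
    = (\<Sum>A\<in>Pow E. p ^ card A * (1 - p) ^ card (insert e E - A) * f A)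
    + (\<Sum>A\<in>Pow E. p ^ card (insert e A) * (1 - p) ^ card (insert e E - insert e A)
          * f (insert e A))"
    unfolding bern_exp_def Pow_insert using 1 assms(1)
    by (subst sum.union_disjoint) (simp_all add: sum.reindex)
  also have "\<dots> = (1 - p) * bern_exp p E f + p * bern_exp p E (\<lambda>A. f (insert e A))"
    unfolding bern_exp_def sum_distrib_left
    by (intro arg_cong2[of _ _ _ _ "(+)"] sum.cong refl) (simp_all only: 2 3)
  finally show ?thesis by simp
qed

lemma bern_exp_cong: "(\<And>A. A \<subseteq> E \<Longrightarrow> f A = g A) \<Longrightarrow> bern_exp p E f = bern_exp p E g"
  unfolding bern_exp_def by (intro sum.cong refl) auto

lemma bern_exp_add: "bern_exp p E (\<lambda>A. f A + g A) = bern_exp p E f + bern_exp p E g"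
  by (simp add: bern_exp_def algebra_simps sum.distrib)

lemma bern_exp_diff: "bern_exp p E (\<lambda>A. f A - g A) = bern_exp p E f - bern_exp p E g"
  by (simp add: bern_exp_def algebra_simps sum_subtractf)

lemma bern_exp_sum: "bern_exp p E (\<lambda>A. \<Sum>i\<in>I. f i A) = (\<Sum>i\<in>I. bern_exp p E (f i))"
  unfolding bern_exp_def sum_distrib_left by (rule sum.swap)

lemma bern_exp_mono:
  "\<lbrakk>0 \<le> p; p \<le> 1; \<And>A. A \<subseteq> E \<Longrightarrow> f A \<le> g A\<rbrakk> \<Longrightarrow> bern_exp p E f \<le> bern_exp p E g"
  unfolding bern_exp_def by (intro sum_mono mult_left_mono) auto

lemma bern_exp_nonneg:
  "\<lbrakk>0 \<le> p; p \<le> 1; \<And>A. A \<subseteq> E \<Longrightarrow> 0 \<le> f A\<rbrakk> \<Longrightarrow> 0 \<le> bern_exp p E f"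
  unfolding bern_exp_def by (intro sum_nonneg mult_nonneg_nonneg) auto

lemma bern_exp_const: "finite E \<Longrightarrow> bern_exp p E (\<lambda>_. c) = c"
  by (induction E rule: finite_induct) (simp_all add: bern_exp_insert algebra_simps)

lemma bern_exp_zero: "finite E \<Longrightarrow> bern_exp 0 E f = f {}"
  by (induction E rule: finite_induct) (simp_all add: bern_exp_insert)

text \<open>Independence of functions that look at disjoint sets \<open>L\<close> and
  \<open>H\<close> of elements: a newly added element can influence at most one factor, so
  conditioning on it keeps the product form.\<close>

lemma bern_exp_indep:
  assumes "finite E" "L \<inter> H = {}" "\<And>A. f (A \<inter> L) = f A" "\<And>A. g (A \<inter> H) = g A"
  shows "bern_exp p E (\<lambda>A. f A * g A) = bern_exp p E f * bern_exp p E g"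
  using assms(1,3,4)
proof (induction E arbitrary: f g rule: finite_induct)
  case empty
  then show ?case by simp
next
  case (insert e E)
  show ?case
  proof (cases "e \<in> L")
    case True
    have "g (insert e A) = g A" for A
      using insert.prems(2)[of "insert e A"] insert.prems(2)[of A] True assms(2)
      by (metis Int_insert_left disjoint_iff)
    moreover have "f (insert e (A \<inter> L)) = f (insert e A)" for A
      using insert.prems(1)[of "insert e A"] True by simp
    ultimately show ?thesis
      using insert.IH[of f g] insert.IH[of "\<lambda>A. f (insert e A)" g] insert.prems insert.hyps
      by (simp add: bern_exp_insert algebra_simps)
  next
    case False
    have f: "f (insert e A) = f A" for A
      using insert.prems(1)[of "insert e A"] insert.prems(1)[of A] False by simp
    have g: "g (insert e (A \<inter> H)) = g (insert e A)" for A
    proof (cases "e \<in> H")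
      case True
      then show ?thesis using insert.prems(2)[of "insert e A"] by simp
    next
      case False
      then show ?thesis
        by (metis insert.prems(2) Int_insert_left inf.right_idem)
    qed
    show ?thesis
      using insert.IH[of f g] insert.IH[of f "\<lambda>A. g (insert e A)"] insert.prems insert.hyps f g
      by (simp add: bern_exp_insert algebra_simps)
  qed
qed

text \<open>An element outside \<open>E'\<close> leaves \<open>f\<close> unchanged, and its two
  weights \<open>p\<close> and \<open>1 - p\<close> add up to 1.\<close>

lemma bern_exp_marginal:
  assumes "finite E" "E' \<subseteq> E" "\<And>A. f (A \<inter> E') = f A"
  shows "bern_exp p E f = bern_exp p E' f"
proof -
  have "bern_exp p (E' \<union> D) f = bern_exp p E' f" if "finite D" "D \<inter> E' = {}" for D
    using that
  proof (induction D rule: finite_induct)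
    case empty
    then show ?case by simp
  next
    case (insert e D)
    have "f (insert e A) = f A" for A
      using assms(3)[of "insert e A"] assms(3)[of A] insert.prems by simp
    then have "bern_exp p (insert e (E' \<union> D)) f = bern_exp p (E' \<union> D) f"
      using insert assms finite_subset
      by (subst bern_exp_insert) (auto simp: algebra_simps)
    then show ?case using insert by simp
  qed
  from this[of "E - E'"] assms show ?thesis by (simp add: Un_absorb1 Diff_Int_distrib2)
qed

lemma bern_exp_image:
  assumes "finite E" "inj h"
  shows "bern_exp p (h ` E) f = bern_exp p E (\<lambda>A. f (h ` A))"
  using assms(1)
proof (induction E arbitrary: f rule: finite_induct)
  case empty
  then show ?case by simp
next
  case (insert e E)
  then show ?case
    using assms(2) by (simp add: bern_exp_insert inj_image_mem_iff)
qed

text \<open>Russo's formula, for arbitrary \<open>f\<close>. Differentiating the factors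
  \<open>p\<close> and \<open>1 - p\<close> in the recursion yields the term of the new element; the
  induction hypothesis yields the others.\<close>

lemma russo_formula:
  assumes "finite E"
  shows "((\<lambda>p. bern_exp p E f) has_real_derivative
           (\<Sum>e\<in>E. bern_exp p E (\<lambda>A. f (insert e A) - f (A - {e})))) (at p)"
  using assms
proof (induction E arbitrary: f rule: finite_induct)
  case empty
  then show ?case by simp
next
  case (insert e E)
  define D where "D g = (\<Sum>a\<in>E. bern_exp p E (\<lambda>A. g (insert a A) - g (A - {a})))"
    for g :: "'a set \<Rightarrow> real"
  \<comment> \<open>The difference does not depend on the state of \<open>e\<close>, so conditioning
    on that state changes nothing.\<close>
  have e: "bern_exp p (insert e E) (\<lambda>A. f (insert e A) - f (A - {e}))
      = bern_exp p E (\<lambda>A. f (insert e A)) - bern_exp p E f"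
  proof -
    have "bern_exp p E (\<lambda>A. f (insert e A) - f (A - {e}))
        = bern_exp p E (\<lambda>A. f (insert e A) - f A)"
      "bern_exp p E (\<lambda>A. f (insert e A) - f (insert e A - {e}))
        = bern_exp p E (\<lambda>A. f (insert e A) - f A)"
      using insert.hyps
      by (intro bern_exp_cong; simp add: subset_iff insert_absorb; metis Diff_empty Diff_insert0)+
    then show ?thesis using insert.hyps
      by (simp add: bern_exp_insert bern_exp_diff algebra_simps)
  qed
  have e': "bern_exp p (insert e E) (\<lambda>A. f (insert a A) - f (A - {a}))
      = p * bern_exp p E (\<lambda>A. f (insert e (insert a A)) - f (insert e (A - {a})))
        + (1 - p) * bern_exp p E (\<lambda>A. f (insert a A) - f (A - {a}))" if "a \<in> E" for a
  proof -
    have "a \<noteq> e" using that insert.hyps by auto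
    then show ?thesis using insert.hyps
      by (simp add: bern_exp_insert insert_commute insert_Diff_if)
  qed
  have "(\<Sum>a\<in>E. bern_exp p (insert e E) (\<lambda>A. f (insert a A) - f (A - {a})))
      = p * D (\<lambda>A. f (insert e A)) + (1 - p) * D f"
    unfolding D_def sum_distrib_left sum.distrib[symmetric]
    by (intro sum.cong refl e')
  moreover have "((\<lambda>p. p * bern_exp p E (\<lambda>A. f (insert e A)) + (1 - p) * bern_exp p E f)
      has_real_derivative
        (bern_exp p E (\<lambda>A. f (insert e A)) - bern_exp p E f
          + (p * D (\<lambda>A. f (insert e A)) + (1 - p) * D f))) (at p)"
    unfolding D_def
    by (rule derivative_eq_intros insert.IH refl)+ (simp add: algebra_simps)
  ultimately show ?case
    unfolding sum.insert[OF insert.hyps] e by (simp only: bern_exp_insert[OF insert.hyps])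
qed

lemma bern_exp_mono_p:
  assumes "finite E" "0 \<le> p" "p \<le> q" "q \<le> 1" "\<And>A B. A \<subseteq> B \<Longrightarrow> f A \<le> f B"
  shows "bern_exp p E f \<le> bern_exp q E f"
proof (rule DERIV_nonneg_imp_nondecreasing[OF assms(3)])
  fix x assume "p \<le> x" "x \<le> q"
  then have "0 \<le> (\<Sum>e\<in>E. bern_exp x E (\<lambda>A. f (insert e A) - f (A - {e})))"
    using assms by (intro sum_nonneg bern_exp_nonneg) (auto intro!: assms(5))
  with russo_formula[OF assms(1)]
  show "\<exists>y. ((\<lambda>p. bern_exp p E f) has_real_derivative y) (at x) \<and> 0 \<le> y" by blast
qed

text \<open>The bridge from product measures to \<open>bern_exp\<close>: an event that depends only
  on which coordinates in \<open>E\<close> fall into \<open>B\<close> is a finite disjoint union of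
  cylinders \<open>cyl A\<close>, one for each admissible pattern \<open>A\<close>.\<close>

lemma measure_PiM_finite_pattern:
  fixes Q :: "'i set \<Rightarrow> bool"
  assumes "prob_space M" "B \<in> sets M" "finite E"
  defines "P \<equiv> PiM UNIV (\<lambda>_::'i. M)"
  shows "{\<omega>\<in>space P. Q {e\<in>E. \<omega> e \<in> B}} \<in> sets P"
    and "measure P {\<omega>\<in>space P. Q {e\<in>E. \<omega> e \<in> B}}
       = bern_exp (measure M B) E (\<lambda>A. of_bool (Q A))"
proof -
  interpret M: prob_space M by fact
  interpret P: product_prob_space "\<lambda>_::'i. M" UNIV by unfold_locales
  define X where "X A e = (if e \<in> A then B else space M - B)" for A :: "'i set" and e
  define cyl where "cyl A = prod_emb UNIV (\<lambda>_. M) E (Pi\<^sub>E E (X A))" for A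
  have cyl: "cyl A = {\<omega>\<in>space P. {e\<in>E. \<omega> e \<in> B} = A}" if "A \<subseteq> E" for A
    using that assms(2)[THEN sets.sets_into_space]
    unfolding cyl_def X_def prod_emb_def P_def space_PiM
    by (auto simp: PiE_def Pi_iff extensional_def restrict_def split: if_splits)
  have cyl_sets: "cyl A \<in> sets P" for A
    unfolding cyl_def P_def using assms by (intro sets_PiM_I) (auto simp: X_def)
  have cyl_meas: "measure P (cyl A) = measure M B ^ card A * (1 - measure M B) ^ card (E - A)"
    if "A \<subseteq> E" for A
  proof -
    have "measure P (cyl A) = (\<Prod>e\<in>E. measure M (X A e))"
      unfolding cyl_def P_def using assms by (intro P.measure_PiM_emb) (auto simp: X_def)
    also have "\<dots> = (\<Prod>e\<in>E. if e \<in> A then measure M B else 1 - measure M B)"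
      using M.prob_compl[OF assms(2)] by (intro prod.cong) (auto simp: X_def)
    also have "\<dots> = measure M B ^ card (E \<inter> A) * (1 - measure M B) ^ card (E \<inter> - A)"
      using assms(3) by (subst prod.If_cases) (simp_all)
    finally show ?thesis using that by (simp add: Int_absorb1 Diff_eq)
  qed
  have eq: "{\<omega>\<in>space P. Q {e\<in>E. \<omega> e \<in> B}} = (\<Union>A\<in>{A\<in>Pow E. Q A}. cyl A)"
    using cyl by auto
  show "{\<omega>\<in>space P. Q {e\<in>E. \<omega> e \<in> B}} \<in> sets P"
    unfolding eq using assms(3) cyl_sets by (intro sets.finite_UN) auto
  have "measure P (\<Union>A\<in>{A\<in>Pow E. Q A}. cyl A) = (\<Sum>A\<in>{A\<in>Pow E. Q A}. measure P (cyl A))"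
    unfolding P_def
  proof (intro P.finite_measure_finite_Union)
    show "disjoint_family_on cyl {A \<in> Pow E. Q A}"
      using cyl by (auto simp: disjoint_family_on_def)
  qed (use assms(3) cyl_sets P_def in auto)
  also have "\<dots> = (\<Sum>A\<in>{A\<in>Pow E. Q A}. measure M B ^ card A * (1 - measure M B) ^ card (E - A))"
    using cyl_meas by (intro sum.cong) auto
  also have "\<dots> = bern_exp (measure M B) E (\<lambda>A. of_bool (Q A))"
    unfolding bern_exp_def using assms(3)
    by (intro sum.mono_neutral_cong_left) auto
  finally show "measure P {\<omega>\<in>space P. Q {e\<in>E. \<omega> e \<in> B}}
       = bern_exp (measure M B) E (\<lambda>A. of_bool (Q A))"
    unfolding eq .
qed


section \<open>Oriented paths with few closed edges\<close>

definition lev :: "vertex \<Rightarrow> int" where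
  "lev v = fst v + snd v"

text \<open>\<open>far A c m u\<close>: from \<open>u\<close> there is a path of length \<open>m\<close> with at most \<open>c\<close> edges outside \<open>A\<close>.\<close>

fun far :: "edge set \<Rightarrow> nat \<Rightarrow> nat \<Rightarrow> vertex \<Rightarrow> bool" where
  "far A c 0 u \<longleftrightarrow> True"
| "far A c (Suc m) u \<longleftrightarrow>
     (\<exists>d. (u, d) \<in> A \<and> far A c m (step u d) \<or> 0 < c \<and> far A (c - 1) m (step u d))"

text \<open>These are the vertices that NE paths from the origin reach in fewer than
  \<open>n\<close> steps, hence the starting points of all edges that paths of length
  \<open>n\<close> can use.\<close>

definition tri :: "nat \<Rightarrow> vertex set" where
  "tri n = {v. 0 \<le> fst v \<and> 0 \<le> snd v \<and> lev v < int n}"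

abbreviation tri_edges :: "nat \<Rightarrow> edge set" where
  "tri_edges n \<equiv> tri n \<times> UNIV"

definition far_prob :: "real \<Rightarrow> nat \<Rightarrow> nat \<Rightarrow> real" where
  "far_prob p m c = bern_exp p (tri_edges m) (\<lambda>A. of_bool (far A c m (0, 0)))"

lemma lev_step [simp]: "lev (step u d) = lev u + 1"
  by (simp add: lev_def step_def)

lemma step_add: "step (y + u) d = y + step u d"
  by (simp add: step_def prod_eq_iff)

lemma step_ge: "fst u \<le> fst (step u d)" "snd u \<le> snd (step u d)"
  by (simp_all add: step_def)

lemma finite_tri [simp]: "finite (tri n)"
proof (rule finite_subset)
  show "tri n \<subseteq> {0..int n} \<times> {0..int n}"
    by (auto simp: tri_def lev_def)
qed simp

lemma far_mono_budget: "far A c m u \<Longrightarrow> c \<le> c' \<Longrightarrow> far A c' m u"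
proof (induction m arbitrary: c c' u)
  case (Suc m)
  then obtain d where "(u, d) \<in> A \<and> far A c m (step u d) \<or> 0 < c \<and> far A (c - 1) m (step u d)"
    by auto
  then have "(u, d) \<in> A \<and> far A c' m (step u d) \<or> 0 < c' \<and> far A (c' - 1) m (step u d)"
    using Suc.IH[of c "step u d" c'] Suc.IH[of "c - 1" "step u d" "c' - 1"]
      diff_le_mono[OF Suc.prems(2), of 1] Suc.prems(2)
    by auto
  then show ?case by auto
qed simp

lemma far_Suc: "far A c (Suc m) u \<Longrightarrow> far A c m u"
proof (induction m arbitrary: c u)
  case (Suc m)
  from Suc.prems obtain d where
    "(u, d) \<in> A \<and> far A c (Suc m) (step u d) \<or> 0 < c \<and> far A (c - 1) (Suc m) (step u d)"
    unfolding far.simps(2)[of A c "Suc m"] by blast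
  then have "(u, d) \<in> A \<and> far A c m (step u d) \<or> 0 < c \<and> far A (c - 1) m (step u d)"
    using Suc.IH by blast
  then show ?case unfolding far.simps(2) by blast
qed simp

lemma far_mono_length: "far A c m u \<Longrightarrow> m' \<le> m \<Longrightarrow> far A c m' u"
  by (induction m) (auto simp: le_Suc_eq dest: far_Suc simp del: far.simps(2))

lemma far_mono: "far A c m u \<Longrightarrow> A \<subseteq> B \<Longrightarrow> far B c m u"
proof (induction m arbitrary: c u)
  case (Suc m)
  then show ?case unfolding far.simps(2) by blast
qed simp

text \<open>Locality: \<open>H\<close> contains every edge that a path of length \<open>m\<close>
  from \<open>u\<close> can use. This supplies the marginals and the independence statements about
  \<open>far\<close>.\<close>

lemma far_Int:
  assumes "\<And>e. fst u \<le> fst (fst e) \<Longrightarrow> snd u \<le> snd (fst e) \<Longrightarrow> lev (fst e) < lev u + int m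
      \<Longrightarrow> (e :: edge) \<in> H"
  shows "far (A \<inter> H) c m u = far A c m u"
  using assms
proof (induction m arbitrary: c u)
  case (Suc m)
  have "far (A \<inter> H) c' m (step u d) = far A c' m (step u d)" for c' d
  proof (rule Suc.IH)
    fix e :: edge
    assume "fst (step u d) \<le> fst (fst e)" "snd (step u d) \<le> snd (fst e)"
      "lev (fst e) < lev (step u d) + int m"
    with step_ge[of u d] show "e \<in> H" by (intro Suc.prems) auto
  qed
  moreover have "(u, d) \<in> H" for d using Suc.prems[of "(u, d)"] by simp
  ultimately show ?case by simp
qed simp

lemma far_translate: "far A c m (y + u) = far {e. (y + fst e, snd e) \<in> A} c m u"
  by (induction m arbitrary: c u) (simp_all add: step_add)

text \<open>By locality the expectation reduces to the triangle shifted to \<open>y\<close>, which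
  fits into \<open>tri_edges N\<close>; the shift \<open>h\<close> then carries it back to the
  origin.\<close>

lemma far_prob_translate:
  assumes "0 \<le> fst y" "0 \<le> snd y" "lev y + int m \<le> int N"
  shows "bern_exp p (tri_edges N) (\<lambda>A. of_bool (far A c m y)) = far_prob p m c"
proof -
  define h where "h e = (y + fst e, snd e)" for e :: edge
  have inj: "inj h" by (auto simp: inj_def h_def prod_eq_iff)
  have h_tri: "h ` tri_edges m = {e. fst y \<le> fst (fst e) \<and> snd y \<le> snd (fst e) \<and> lev (fst e) < lev y + int m}"
  proof (intro equalityI subsetI)
    fix e :: edge assume e: "e \<in> {e. fst y \<le> fst (fst e) \<and> snd y \<le> snd (fst e) \<and> lev (fst e) < lev y + int m}"
    then show "e \<in> h ` tri_edges m"
      by (intro image_eqI[of _ _ "(fst e - y, snd e)"]) (auto simp: h_def tri_def lev_def)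
  qed (auto simp: h_def tri_def lev_def)
  have "bern_exp p (tri_edges N) (\<lambda>A. of_bool (far A c m y) :: real)
      = bern_exp p (h ` tri_edges m) (\<lambda>A. of_bool (far A c m y))"
  proof (rule bern_exp_marginal)
    show "h ` tri_edges m \<subseteq> tri_edges N"
      unfolding h_tri using assms by (auto simp: tri_def)
    show "of_bool (far (A \<inter> h ` tri_edges m) c m y) = (of_bool (far A c m y) :: real)" for A
      by (subst far_Int) (auto simp: h_tri)
  qed simp
  also have "\<dots> = bern_exp p (tri_edges m) (\<lambda>A. of_bool (far (h ` A) c m y))"
    using inj by (intro bern_exp_image) auto
  also have "\<dots> = far_prob p m c"
  proof -
    have "far (h ` A) c m y = far A c m (0, 0)" for A
      using far_translate[of "h ` A" c m y "(0,0)"] inj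
      by (simp add: h_def[symmetric] inj_image_mem_iff zero_prod_def[symmetric])
    then show ?thesis by (simp add: far_prob_def)
  qed
  finally show ?thesis .
qed

lemma far_prob_bounds:
  assumes "0 \<le> p" "p \<le> 1"
  shows "0 \<le> far_prob p m c" "far_prob p m c \<le> 1"
proof -
  show "0 \<le> far_prob p m c"
    unfolding far_prob_def using assms by (intro bern_exp_nonneg) auto
  have "far_prob p m c \<le> bern_exp p (tri_edges m) (\<lambda>_. 1)"
    unfolding far_prob_def using assms by (intro bern_exp_mono) auto
  then show "far_prob p m c \<le> 1" by (simp add: bern_exp_const)
qed

section \<open>Exits from a finite set\<close>

text \<open>Read \<open>opath A S x u\<close> as an open path inside \<open>S\<close> from
  \<open>u\<close> to \<open>x\<close>. The end \<open>x\<close> is the fixed parameter because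
  steps are prepended at the start.\<close>

inductive opath :: "edge set \<Rightarrow> vertex set \<Rightarrow> vertex \<Rightarrow> vertex \<Rightarrow> bool" for A S x where
  opath_refl: "opath A S x x"
| opath_step: "(u, d) \<in> A \<Longrightarrow> u \<in> S \<Longrightarrow> step u d \<in> S \<Longrightarrow> opath A S x (step u d) \<Longrightarrow> opath A S x u"

definition exit_edges :: "vertex set \<Rightarrow> edge set" where
  "exit_edges S = {e. fst e \<in> S \<and> step (fst e) (snd e) \<notin> S}"

text \<open>The functional of Duminil-Copin and Tassion, without the factor for the state of the
  exit edge itself.\<close>

definition exit_mass :: "real \<Rightarrow> vertex set \<Rightarrow> real" where
  "exit_mass p S =
     (\<Sum>e\<in>exit_edges S. bern_exp p (S \<times> UNIV) (\<lambda>A. of_bool (opath A S (fst e) (0, 0))))"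

lemma finite_exit_edges: "finite S \<Longrightarrow> finite (exit_edges S)"
  by (rule finite_subset[of _ "S \<times> UNIV"]) (auto simp: exit_edges_def)

lemma opath_lev: "opath A S x u \<Longrightarrow> lev u \<le> lev x"
  by (induction rule: opath.induct) auto

lemma opath_mono: "opath A S x u \<Longrightarrow> A \<subseteq> B \<Longrightarrow> opath B S x u"
proof (induction rule: opath.induct)
  case (opath_step u d)
  then show ?case by (intro opath.opath_step[of u d]) auto
qed (rule opath.opath_refl)

lemma opath_Int:
  assumes "\<And>e. fst e \<in> S \<Longrightarrow> step (fst e) (snd e) \<in> S \<Longrightarrow> lev (fst e) < lev x \<Longrightarrow> e \<in> H"
  shows "opath (A \<inter> H) S x u = opath A S x u"
proof
  assume "opath A S x u"
  then show "opath (A \<inter> H) S x u"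
  proof (induction rule: opath.induct)
    case (opath_step u d)
    have "(u, d) \<in> H" using opath_step opath_lev[OF opath_step.hyps(4)] by (intro assms) auto
    with opath_step show ?case by (intro opath.opath_step[of u d]) auto
  qed (rule opath.opath_refl)
qed (erule opath_mono, blast)

text \<open>Levels in \<open>S\<close> stay below \<open>L\<close>, so the path must leave
  \<open>S\<close> with at least \<open>r\<close> steps to go. If all its edges up to and including
  the exit are open, the first alternative holds; otherwise a closed edge has used up part of the
  budget.\<close>

lemma far_exit:
  assumes "far A c m u" "u \<in> S" "\<And>x. x \<in> S \<Longrightarrow> lev x < L" "L + int r \<le> lev u + int m"
  shows "\<exists>e\<in>exit_edges S. (opath A S (fst e) u \<and> far A c r (step (fst e) (snd e)))
           \<or> (0 < c \<and> far A (c - 1) r (step (fst e) (snd e)))"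
  using assms(1,2,4)
proof (induction m arbitrary: c u)
  case 0
  then show ?case using assms(3)[of u] by simp
next
  case (Suc m)
  from Suc.prems obtain d where
    d: "(u, d) \<in> A \<and> far A c m (step u d) \<or> 0 < c \<and> far A (c - 1) m (step u d)" by auto
  show ?case
  proof (cases "step u d \<in> S")
    case False
    have "r \<le> m" using assms(3)[OF Suc.prems(2)] Suc.prems(3) by simp
    then show ?thesis
      using d False Suc.prems(2) opath_refl[of A S u]
      by (intro bexI[of _ "(u, d)"]) (auto simp: exit_edges_def intro: far_mono_length)
  next
    case True
    from d show ?thesis
    proof
      assume *: "(u, d) \<in> A \<and> far A c m (step u d)"
      with Suc.IH[of c "step u d"] True Suc.prems(3) obtain e where
        "e \<in> exit_edges S"
        "(opath A S (fst e) (step u d) \<and> far A c r (step (fst e) (snd e)))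
           \<or> (0 < c \<and> far A (c - 1) r (step (fst e) (snd e)))" by auto
      then show ?thesis using * True Suc.prems(2) by (blast intro: opath_step)
    next
      assume *: "0 < c \<and> far A (c - 1) m (step u d)"
      with Suc.IH[of "c - 1" "step u d"] True Suc.prems(3) obtain e where
        "e \<in> exit_edges S" "far A (c - 1) r (step (fst e) (snd e))
          \<or> far A (c - 1 - 1) r (step (fst e) (snd e))" by auto
      then show ?thesis
        using * far_mono_budget[of A "c - 1 - 1" r _ "c - 1"] by (metis diff_le_self)
    qed
  qed
qed

lemma tri_step: "u \<in> tri n \<Longrightarrow> 0 \<le> fst (step u d) \<and> 0 \<le> snd (step u d) \<and> lev (step u d) \<le> int n"
  using step_ge[of u d] by (auto simp: tri_def)

lemma exit_mass_tri:
  assumes "S \<subseteq> tri n" "n \<le> N"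
  shows "exit_mass p S
       = (\<Sum>e\<in>exit_edges S. bern_exp p (tri_edges N) (\<lambda>A. of_bool (opath A S (fst e) (0, 0))))"
  unfolding exit_mass_def
proof (rule sum.cong[OF refl], rule bern_exp_marginal[symmetric])
  show "S \<times> UNIV \<subseteq> tri_edges N" using assms by (fastforce simp: tri_def)
  show "of_bool (opath (A \<inter> S \<times> UNIV) S (fst e) (0, 0)) = (of_bool (opath A S (fst e) (0, 0)) :: real)"
    for A e
    by (subst opath_Int) auto
qed simp

text \<open>A union bound over the exit edges and the two alternatives of \<open>far_exit\<close>.
  For an intact budget the two path pieces are independent, which produces \<open>exit_mass\<close>;
  for a reduced budget the piece inside \<open>S\<close> is dropped, which produces the number of
  exit edges.\<close>

lemma far_prob_exit:
  assumes "S \<subseteq> tri n" "(0, 0) \<in> S" "0 \<le> p" "p \<le> 1"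
  shows "far_prob p (r + n) c \<le> exit_mass p S * far_prob p r c
    + (if c = 0 then 0 else real (card (exit_edges S)) * far_prob p r (c - 1))"
proof -
  let ?N = "r + n"
  let ?X = "exit_edges S"
  define tgt where "tgt e = step (fst e) (snd e)" for e :: edge
  have fin: "finite ?X" using finite_subset[OF assms(1)] by (simp add: finite_exit_edges)
  have tgt: "0 \<le> fst (tgt e) \<and> 0 \<le> snd (tgt e) \<and> lev (tgt e) + int r \<le> int ?N" if "e \<in> ?X" for e
    using that assms(1) tri_step[of "fst e" n "snd e"] by (auto simp: exit_edges_def tgt_def)
  \<comment> \<open>The path inside \<open>S\<close> uses levels below that of the exit edge, the
    continuation only levels above it.\<close>
  have indep: "bern_exp p (tri_edges ?N) (\<lambda>A. of_bool (opath A S (fst e) (0,0)) * of_bool (far A c r (tgt e)))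
      = bern_exp p (tri_edges ?N) (\<lambda>A. of_bool (opath A S (fst e) (0,0))) * far_prob p r c"
    if e: "e \<in> ?X" for e
  proof -
    have "bern_exp p (tri_edges ?N) (\<lambda>A. of_bool (opath A S (fst e) (0,0)) * of_bool (far A c r (tgt e)))
      = bern_exp p (tri_edges ?N) (\<lambda>A. of_bool (opath A S (fst e) (0,0)))
        * bern_exp p (tri_edges ?N) (\<lambda>A. of_bool (far A c r (tgt e)))"
    proof (rule bern_exp_indep)
      show "{a. lev (fst a) < lev (fst e)} \<inter> {a. lev (fst e) < lev (fst a)} = {}" by auto
      show "of_bool (opath (A \<inter> {a. lev (fst a) < lev (fst e)}) S (fst e) (0, 0))
          = (of_bool (opath A S (fst e) (0, 0)) :: real)" for A
        by (subst opath_Int) auto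
      show "of_bool (far (A \<inter> {a. lev (fst e) < lev (fst a)}) c r (tgt e))
          = (of_bool (far A c r (tgt e)) :: real)" for A
        by (subst far_Int) (auto simp: tgt_def step_def lev_def split: if_splits)
    qed simp
    then show ?thesis using far_prob_translate[of "tgt e" r ?N p c] tgt[OF e] by simp
  qed
  have "far_prob p ?N c \<le> bern_exp p (tri_edges ?N) (\<lambda>A. \<Sum>e\<in>?X.
      of_bool (opath A S (fst e) (0,0)) * of_bool (far A c r (tgt e))
      + (if c = 0 then 0 else of_bool (far A (c - 1) r (tgt e))))"
    unfolding far_prob_def
  proof (rule bern_exp_mono)
    fix A :: "edge set"
    let ?f = "\<lambda>e. of_bool (opath A S (fst e) (0,0)) * of_bool (far A c r (tgt e))
      + (if c = 0 then 0 else of_bool (far A (c - 1) r (tgt e))) :: real"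
    show "of_bool (far A c ?N (0, 0)) \<le> sum ?f ?X"
    proof (cases "far A c ?N (0, 0)")
      case True
      have "\<exists>e\<in>exit_edges S. (opath A S (fst e) (0,0) \<and> far A c r (step (fst e) (snd e)))
           \<or> (0 < c \<and> far A (c - 1) r (step (fst e) (snd e)))"
        by (rule far_exit[OF True assms(2), of "int n"]) (use assms(1) in \<open>auto simp: tri_def lev_def\<close>)
      then obtain e where e: "e \<in> ?X" "1 \<le> ?f e"
        by (auto simp: tgt_def)
      then have "1 \<le> sum ?f ?X"
        using member_le_sum[OF e(1), of ?f] fin by force
      then show ?thesis using True by simp
    qed (auto intro!: sum_nonneg)
  qed (use assms in auto)
  also have "\<dots> = (\<Sum>e\<in>?X. bern_exp p (tri_edges ?N) (\<lambda>A. of_bool (opath A S (fst e) (0,0))) * far_prob p r c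
      + (if c = 0 then 0 else far_prob p r (c - 1)))"
    unfolding bern_exp_sum
  proof (rule sum.cong[OF refl])
    fix e assume e: "e \<in> ?X"
    show "bern_exp p (tri_edges ?N) (\<lambda>A. of_bool (opath A S (fst e) (0,0)) * of_bool (far A c r (tgt e))
        + (if c = 0 then 0 else of_bool (far A (c - 1) r (tgt e))))
      = bern_exp p (tri_edges ?N) (\<lambda>A. of_bool (opath A S (fst e) (0,0))) * far_prob p r c
        + (if c = 0 then 0 else far_prob p r (c - 1))"
      using indep[OF e] far_prob_translate[of "tgt e" r ?N p "c - 1"] tgt[OF e]
      by (simp add: bern_exp_add bern_exp_const)
  qed
  also have "\<dots> = exit_mass p S * far_prob p r c
    + (if c = 0 then 0 else real (card ?X) * far_prob p r (c - 1))"
    using assms(1) by (simp add: exit_mass_tri[of S n ?N] sum.distrib sum_distrib_right)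
  finally show ?thesis .
qed

text \<open>Iteration of \<open>far_prob_exit\<close>. Under the weight \<open>K ^ c\<close> a lost
  unit of budget gains a factor \<open>1 / K\<close>, so a large \<open>K\<close> makes the second
  term harmless and each block of \<open>n\<close> levels costs a factor
  \<open>\<rho>\<close>.\<close>

lemma far_prob_decay:
  assumes "S \<subseteq> tri n" "(0, 0) \<in> S" "0 \<le> p" "p \<le> 1" "1 \<le> K"
    "exit_mass p S + real (card (exit_edges S)) / K \<le> \<rho>"
  shows "far_prob p (k * n) c \<le> \<rho> ^ k * K ^ c"
proof (induction k arbitrary: c)
  case 0
  have "far_prob p 0 c \<le> 1" using far_prob_bounds assms by blast
  also have "1 \<le> K ^ c" using assms by simp
  finally show ?case by simp
next
  case (Suc k)
  let ?D = "real (card (exit_edges S))"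
  have em: "0 \<le> exit_mass p S"
    unfolding exit_mass_def using assms by (intro sum_nonneg bern_exp_nonneg) auto
  have \<rho>: "0 \<le> \<rho>" using em assms(5,6) by (smt (verit) divide_nonneg_nonneg of_nat_0_le_iff)
  have "far_prob p (Suc k * n) c \<le> exit_mass p S * far_prob p (k * n) c
      + (if c = 0 then 0 else ?D * far_prob p (k * n) (c - 1))"
    using far_prob_exit[OF assms(1-4), of "k * n" c] by (simp add: add.commute)
  also have "\<dots> \<le> exit_mass p S * (\<rho> ^ k * K ^ c) + ?D / K * (\<rho> ^ k * K ^ c)"
  proof (rule add_mono)
    show "exit_mass p S * far_prob p (k * n) c \<le> exit_mass p S * (\<rho> ^ k * K ^ c)"
      using Suc.IH em by (intro mult_left_mono)
    show "(if c = 0 then 0 else ?D * far_prob p (k * n) (c - 1)) \<le> ?D / K * (\<rho> ^ k * K ^ c)"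
    proof (cases c)
      case 0
      then show ?thesis using \<rho> assms(5) by simp
    next
      case (Suc c')
      have "?D * far_prob p (k * n) c' \<le> ?D * (\<rho> ^ k * K ^ c')"
        using Suc.IH by (intro mult_left_mono) auto
      also have "\<dots> = ?D / K * (\<rho> ^ k * K ^ c)" using Suc assms(5) by simp
      finally show ?thesis using Suc by simp
    qed
  qed
  also have "\<dots> = (exit_mass p S + ?D / K) * (\<rho> ^ k * K ^ c)" by (simp add: algebra_simps)
  also have "\<dots> \<le> \<rho> * (\<rho> ^ k * K ^ c)"
    using assms \<rho> by (intro mult_right_mono) auto
  finally show ?case by (simp add: mult.assoc)
qed


section \<open>The differential inequality\<close>

text \<open>The event of \<open>far\<close> with budget 0, indexed by the target level instead of
  the remaining length: the target stays fixed along the path, so vertices at different levels can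
  be compared.\<close>

inductive up :: "edge set \<Rightarrow> int \<Rightarrow> vertex \<Rightarrow> bool" for A n where
  up_level: "lev u = n \<Longrightarrow> up A n u"
| up_step: "(u, d) \<in> A \<Longrightarrow> up A n (step u d) \<Longrightarrow> up A n u"

lemma up_mono: "up A n u \<Longrightarrow> A \<subseteq> B \<Longrightarrow> up B n u"
proof (induction rule: up.induct)
  case (up_step u d)
  then show ?case by (intro up.up_step[of u d]) auto
qed (rule up.up_level)

lemma far_iff_up: "far A 0 m u \<longleftrightarrow> up A (lev u + int m) u"
proof
  show "up A (lev u + int m) u" if "far A 0 m u"
    using that
  proof (induction m arbitrary: u)
    case (Suc m)
    then obtain d where "(u, d) \<in> A" "far A 0 m (step u d)" by auto
    with Suc.IH[of "step u d"] show ?case by (intro up_step[of u d]) (simp_all add: add_ac)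
  qed (simp add: up_level)
  have "far A 0 (nat (n - lev u)) u \<and> lev u \<le> n" if "up A n u" for n
    using that
  proof (induction rule: up.induct)
    case (up_step u d)
    then have "nat (n - lev u) = Suc (nat (n - lev (step u d)))"
      unfolding lev_step by (elim conjE) arith
    with up_step show ?case by auto
  qed simp
  from this[of "lev u + int m"] show "far A 0 m u" if "up A (lev u + int m) u"
    using that by simp
qed

text \<open>The random set whose possible values \<open>S\<close> are fed into
  \<open>exit_mass\<close> in the differential inequality.\<close>

definition dead :: "nat \<Rightarrow> edge set \<Rightarrow> vertex set" where
  "dead n A = {u \<in> tri n. \<not> up A (int n) u}"

text \<open>The far end of an edge leaving the dead set reaches level \<open>n\<close>, being either
  a live vertex or on that level. Opening the edge therefore connects its near end.\<close>

lemma exit_dead_up: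
  assumes "e \<in> exit_edges (dead n A)" "e \<in> B"
  shows "up (A \<union> B) (int n) (fst e)"
proof -
  let ?v = "step (fst e) (snd e)"
  from assms(1) have e: "fst e \<in> tri n" "?v \<notin> dead n A" by (auto simp: exit_edges_def dead_def)
  have "up A (int n) ?v"
  proof (cases "?v \<in> tri n")
    case False
    then have "lev ?v = int n" using tri_step[OF e(1), of "snd e"] by (auto simp: tri_def)
    then show ?thesis by (rule up_level)
  qed (use e in \<open>auto simp: dead_def\<close>)
  then show ?thesis
    using assms(2) up_mono[of A _ ?v "A \<union> B"] by (intro up_step[of "fst e" "snd e"]) auto
qed

lemma opath_up: "opath A S x u \<Longrightarrow> A \<subseteq> B \<Longrightarrow> up B n x \<Longrightarrow> up B n u"
proof (induction rule: opath.induct)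
  case (opath_step u d)
  then show ?case by (intro up_step[of u d]) auto
qed

text \<open>The event that a given set is the set of dead vertices is decided by the edges that do not
  run inside this set; this makes it independent of the open paths inside the set.\<close>

lemma dead_eq_Int:
  assumes "\<And>e. \<not> (fst e \<in> S \<and> step (fst e) (snd e) \<in> S) \<Longrightarrow> e \<in> J"
  shows "dead n (A \<inter> J) = S \<longleftrightarrow> dead n A = S"
proof
  assume S: "dead n (A \<inter> J) = S"
  \<comment> \<open>A connection from \<open>S\<close> restored by the edges of \<open>A\<close>
    would have to leave \<open>S\<close> through an edge of \<open>J\<close>, and then it would
    already exist in \<open>A \<inter> J\<close>.\<close>
  have "up A (int n) u \<Longrightarrow> u \<in> tri n \<Longrightarrow> u \<notin> S" for u
  proof (induction rule: up.induct)
    case (up_step u d)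
    show ?case
    proof
      assume "u \<in> S"
      have v: "step u d \<notin> S"
        using up_step.IH S by (auto simp: dead_def)
      then have "(u, d) \<in> exit_edges (dead n (A \<inter> J))" "(u, d) \<in> A \<inter> J"
        using \<open>u \<in> S\<close> S assms[of "(u, d)"] up_step.hyps by (auto simp: exit_edges_def)
      from exit_dead_up[OF this] have "up (A \<inter> J) (int n) u" by simp
      with \<open>u \<in> S\<close> S show False by (auto simp: dead_def)
    qed
  qed (auto simp: tri_def)
  moreover have "dead n A \<subseteq> S"
    using S by (auto simp: dead_def dest: up_mono[of "A \<inter> J" _ _ A])
  ultimately show "dead n A = S"
    using S by (auto simp: dead_def)
next
  assume S: "dead n A = S"
  have "up (A \<inter> J) (int n) u" if "up A (int n) u" for u
    using that
  proof (induction rule: up.induct)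
    case (up_step u d)
    have "u \<notin> S" using S up.up_step[OF up_step.hyps] by (auto simp: dead_def)
    then have "(u, d) \<in> A \<inter> J" using assms[of "(u, d)"] up_step.hyps by simp
    then show ?case using up_step.IH by (rule up.up_step)
  qed (rule up_level)
  then have "up (A \<inter> J) (int n) u \<longleftrightarrow> up A (int n) u" for u
    using up_mono[of "A \<inter> J" _ u A] by blast
  then show "dead n (A \<inter> J) = S" using S by (simp add: dead_def)
qed

lemma far_0_up: "far A 0 n (0, 0) \<longleftrightarrow> up A (int n) (0, 0)"
  by (simp add: far_iff_up lev_def)

lemma dead_origin: "0 < n \<Longrightarrow> (0, 0) \<in> dead n A \<longleftrightarrow> \<not> far A 0 n (0, 0)"
  by (simp add: dead_def far_0_up tri_def lev_def)

text \<open>If the origin is dead, an edge that leaves the dead set and is reached from the origin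
  by an open path inside it is pivotal. Given that the dead set is \<open>S\<close>, the expected
  number of such edges is \<open>exit_mass p S\<close>, which is at least 1.\<close>

lemma far_prob_deriv:
  assumes "0 \<le> p" "p \<le> 1" "0 < n"
    "\<And>S. S \<subseteq> tri n \<Longrightarrow> (0, 0) \<in> S \<Longrightarrow> 1 \<le> exit_mass p S"
  obtains y where "((\<lambda>p. far_prob p n 0) has_real_derivative y) (at p)" "1 - far_prob p n 0 \<le> y"
proof
  let ?E = "tri_edges n"
  let ?f = "\<lambda>A. of_bool (far A 0 n (0, 0)) :: real"
  let ?y = "\<Sum>e\<in>?E. bern_exp p ?E (\<lambda>A. ?f (insert e A) - ?f (A - {e}))"
  let ?I = "{S \<in> Pow (tri n). (0, 0) \<in> S}"
  let ?op = "\<lambda>S (e :: edge) A. of_bool (opath A S (fst e) (0, 0)) :: real"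
  have fin: "finite ?E" "finite ?I" by simp_all
  show "((\<lambda>p. far_prob p n 0) has_real_derivative ?y) (at p)"
    unfolding far_prob_def by (rule russo_formula) simp
  have "1 - far_prob p n 0 = bern_exp p ?E (\<lambda>A. 1 - ?f A)"
    unfolding far_prob_def by (simp add: bern_exp_diff bern_exp_const)
  \<comment> \<open>Level \<open>n\<close> is not reached exactly when the dead set contains the
    origin; split according to its value.\<close>
  also have "\<dots> = bern_exp p ?E (\<lambda>A. \<Sum>S\<in>?I. of_bool (dead n A = S))"
  proof (rule bern_exp_cong)
    fix A
    have "(\<Sum>S\<in>?I. of_bool (dead n A = S)) = (of_bool (dead n A \<in> ?I) :: real)"
      using fin by (simp add: of_bool_def sum.delta')
    then show "1 - ?f A = (\<Sum>S\<in>?I. of_bool (dead n A = S))"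
      using dead_origin[OF assms(3), of A] by (auto simp: dead_def)
  qed
  also have "\<dots> = (\<Sum>S\<in>?I. bern_exp p ?E (\<lambda>A. of_bool (dead n A = S)) * 1)"
    by (simp only: bern_exp_sum mult_1_right)
  also have "\<dots> \<le> (\<Sum>S\<in>?I. bern_exp p ?E (\<lambda>A. of_bool (dead n A = S)) * exit_mass p S)"
    using assms by (intro sum_mono mult_left_mono bern_exp_nonneg) auto
  \<comment> \<open>The event that the dead set is \<open>S\<close> looks at edges not running
    inside \<open>S\<close>, the open path only at edges that do.\<close>
  also have "\<dots> = (\<Sum>S\<in>?I. \<Sum>e\<in>exit_edges S.
      bern_exp p ?E (\<lambda>A. of_bool (dead n A = S) * ?op S e A))"
  proof (rule sum.cong[OF refl])
    fix S assume S: "S \<in> ?I"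
    have "bern_exp p ?E (\<lambda>A. of_bool (dead n A = S) * ?op S e A)
       = bern_exp p ?E (\<lambda>A. of_bool (dead n A = S)) * bern_exp p ?E (?op S e)" for e
    proof (rule bern_exp_indep)
      let ?int = "{e. fst e \<in> S \<and> step (fst e) (snd e) \<in> S}"
      show "- ?int \<inter> ?int = {}" by auto
      show "of_bool (dead n (A \<inter> - ?int) = S) = (of_bool (dead n A = S) :: real)" for A
        by (subst dead_eq_Int) auto
      show "?op S e (A \<inter> ?int) = ?op S e A" for A
        by (subst opath_Int) auto
    qed simp
    moreover have "exit_mass p S = (\<Sum>e\<in>exit_edges S. bern_exp p ?E (?op S e))"
      using S by (intro exit_mass_tri) auto
    ultimately show "bern_exp p ?E (\<lambda>A. of_bool (dead n A = S)) * exit_mass p S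
      = (\<Sum>e\<in>exit_edges S. bern_exp p ?E (\<lambda>A. of_bool (dead n A = S) * ?op S e A))"
      by (simp only: sum_distrib_left)
  qed
  also have "\<dots> = (\<Sum>S\<in>?I. \<Sum>e\<in>?E.
      bern_exp p ?E (\<lambda>A. of_bool (e \<in> exit_edges S) * (of_bool (dead n A = S) * ?op S e A)))"
  proof (rule sum.cong[OF refl], rule sum.mono_neutral_cong_left)
    fix S assume "S \<in> ?I"
    then show "exit_edges S \<subseteq> ?E" by (auto simp: exit_edges_def)
    show "\<forall>e\<in>?E - exit_edges S. bern_exp p ?E
        (\<lambda>A. of_bool (e \<in> exit_edges S) * (of_bool (dead n A = S) * ?op S e A)) = 0"
      by (simp add: bern_exp_const)
  next
    fix S e assume "e \<in> exit_edges S"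
    then show "bern_exp p ?E (\<lambda>A. of_bool (dead n A = S) * ?op S e A)
        = bern_exp p ?E (\<lambda>A. of_bool (e \<in> exit_edges S) * (of_bool (dead n A = S) * ?op S e A))"
      by simp
  qed simp
  also have "\<dots> = (\<Sum>e\<in>?E. bern_exp p ?E (\<lambda>A. \<Sum>S\<in>?I.
      of_bool (e \<in> exit_edges S) * (of_bool (dead n A = S) * ?op S e A)))"
    unfolding bern_exp_sum by (rule sum.swap)
  also have "\<dots> \<le> ?y"
  proof (intro sum_mono bern_exp_mono)
    fix e A
    have mono: "far (A - {e}) 0 n (0, 0) \<Longrightarrow> far (insert e A) 0 n (0, 0)"
      "far (A - {e}) 0 n (0, 0) \<Longrightarrow> far A 0 n (0, 0)"
      using far_mono[of "A - {e}" 0 n _ "insert e A"] far_mono[of "A - {e}" 0 n _ A] by auto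
    have "(\<Sum>S\<in>?I. of_bool (e \<in> exit_edges S) * (of_bool (dead n A = S) * ?op S e A))
        = (\<Sum>S\<in>?I. if dead n A = S
            then of_bool (e \<in> exit_edges (dead n A)) * ?op (dead n A) e A else 0)"
      by (intro sum.cong) auto
    also have "\<dots> = (if dead n A \<in> ?I
            then of_bool (e \<in> exit_edges (dead n A)) * ?op (dead n A) e A else 0)"
      using fin by (simp add: sum.delta')
    \<comment> \<open>For fixed \<open>A\<close> only the term with \<open>S = dead n A\<close>
      survived. It equals 1 only if level \<open>n\<close> is not reached in \<open>A\<close>, but
      is reached once \<open>e\<close> is opened.\<close>
    also have "\<dots> \<le> ?f (insert e A) - ?f (A - {e})"
    proof (cases "dead n A \<in> ?I \<and> e \<in> exit_edges (dead n A) \<and> opath A (dead n A) (fst e) (0, 0)")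
      case True
      then have "up (insert e A) (int n) (fst e)"
        using exit_dead_up[of e n A "{e}"] by simp
      with True have "up (insert e A) (int n) (0, 0)"
        using opath_up[of A _ "fst e" "(0, 0)" "insert e A"] by auto
      then have "far (insert e A) 0 n (0, 0)" by (simp add: far_0_up)
      moreover have "\<not> far A 0 n (0, 0)" using True dead_origin[OF assms(3), of A] by simp
      ultimately show ?thesis using mono True by auto
    next
      case False
      then show ?thesis using mono(1) by auto
    qed
    finally show "(\<Sum>S\<in>?I. of_bool (e \<in> exit_edges S) * (of_bool (dead n A = S) * ?op S e A))
        \<le> ?f (insert e A) - ?f (A - {e})" .
  qed (use assms in auto)
  finally show "1 - far_prob p n 0 \<le> ?y" .
qed

lemma exit_mass_mono:
  assumes "finite S" "0 \<le> p" "p \<le> q" "q \<le> 1"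
  shows "exit_mass p S \<le> exit_mass q S"
  unfolding exit_mass_def
proof (intro sum_mono bern_exp_mono_p)
  show "of_bool (opath A S (fst e) (0, 0)) \<le> (of_bool (opath B S (fst e) (0, 0)) :: real)"
    if "A \<subseteq> B" for e and A B :: "edge set"
    using opath_mono[OF _ that] by simp
qed (use assms in auto)

text \<open>By the differential inequality \<open>(1 - far_prob t n 0) * exp t\<close> is
  nonincreasing in \<open>t\<close> on \<open>[q, p]\<close>. The assumption at \<open>q\<close>
  carries over to larger densities because \<open>exit_mass\<close> is monotone.\<close>

lemma far_prob_lower_bound:
  assumes "0 \<le> q" "q \<le> p" "p \<le> 1"
    "\<And>S. S \<subseteq> tri n \<Longrightarrow> (0, 0) \<in> S \<Longrightarrow> 1 \<le> exit_mass q S"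
  shows "1 - exp (q - p) \<le> far_prob p n 0"
proof (cases "n = 0")
  case True
  then show ?thesis by (simp add: far_prob_def bern_exp_const)
next
  case False
  have "(1 - far_prob p n 0) * exp p \<le> (1 - far_prob q n 0) * exp q"
  proof (rule DERIV_nonpos_imp_nonincreasing[OF assms(2)])
    fix t assume t: "q \<le> t" "t \<le> p"
    have "1 \<le> exit_mass t S" if "S \<subseteq> tri n" "(0, 0) \<in> S" for S
      using assms(4)[OF that] exit_mass_mono[of S q t] finite_subset[OF that(1)] t assms by simp
    then obtain y where y: "((\<lambda>p. far_prob p n 0) has_real_derivative y) (at t)"
      "1 - far_prob t n 0 \<le> y"
      using far_prob_deriv[of t n] False t assms by auto
    have "((\<lambda>t. (1 - far_prob t n 0) * exp t) has_real_derivative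
        (- y) * exp t + exp t * (1 - far_prob t n 0)) (at t)"
      using y(1) by (auto intro!: derivative_eq_intros)
    moreover have "(- y) * exp t + exp t * (1 - far_prob t n 0) \<le> 0"
      using mult_left_mono[OF y(2), of "exp t"] by (simp add: algebra_simps)
    ultimately show "\<exists>y. ((\<lambda>t. (1 - far_prob t n 0) * exp t) has_real_derivative y) (at t) \<and> y \<le> 0"
      by blast
  qed
  also have "\<dots> \<le> exp q"
    using far_prob_bounds[of q n 0] assms by (simp add: algebra_simps)
  finally have "(1 - far_prob p n 0) * exp p * exp (- p) \<le> exp q * exp (- p)"
    by (rule mult_right_mono) simp
  then have "1 - far_prob p n 0 \<le> exp (q - p)"
    by (simp add: mult.assoc exp_add[symmetric])
  then show ?thesis by simp
qed


section \<open>Transfer to the product spaces\<close>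

lemma far_iff_path:
  "far A c m u \<longleftrightarrow>
     (\<exists>ss. length ss = m \<and> length (filter (\<lambda>e. e \<notin> A) (path_edges u ss)) \<le> c)"
proof
  show "\<exists>ss. length ss = m \<and> length (filter (\<lambda>e. e \<notin> A) (path_edges u ss)) \<le> c"
    if "far A c m u"
    using that
  proof (induction m arbitrary: c u)
    case (Suc m)
    then obtain d where
      "(u, d) \<in> A \<and> far A c m (step u d) \<or> 0 < c \<and> far A (c - 1) m (step u d)" by auto
    then show ?case
    proof
      assume *: "(u, d) \<in> A \<and> far A c m (step u d)"
      with Suc.IH[of c "step u d"] obtain ss where
        "length ss = m" "length (filter (\<lambda>e. e \<notin> A) (path_edges (step u d) ss)) \<le> c" by blast
      with * show ?case by (intro exI[of _ "d # ss"]) simp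
    next
      assume *: "0 < c \<and> far A (c - 1) m (step u d)"
      with Suc.IH[of "c - 1" "step u d"] obtain ss where
        "length ss = m" "length (filter (\<lambda>e. e \<notin> A) (path_edges (step u d) ss)) \<le> c - 1" by blast
      with * show ?case by (intro exI[of _ "d # ss"]) auto
    qed
  qed simp
  have "far A c (length ss) u" if "length (filter (\<lambda>e. e \<notin> A) (path_edges u ss)) \<le> c" for ss
    using that
  proof (induction ss arbitrary: c u)
    case (Cons d ss)
    show ?case
    proof (cases "(u, d) \<in> A")
      case True
      then have "far A c (length ss) (step u d)"
        using Cons.prems by (intro Cons.IH) simp
      with True show ?thesis by auto
    next
      case False
      then have "0 < c" "length (filter (\<lambda>e. e \<notin> A) (path_edges (step u d) ss)) \<le> c - 1"
        using Cons.prems by auto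
      with Cons.IH[of "step u d" "c - 1"] show ?thesis by auto
    qed
  qed simp
  then show "far A c m u"
    if "\<exists>ss. length ss = m \<and> length (filter (\<lambda>e. e \<notin> A) (path_edges u ss)) \<le> c"
    using that by blast
qed

lemma percolates_iff_far: "percolates \<omega> \<longleftrightarrow> (\<forall>n. far {e. \<omega> e} 0 n (0, 0))"
  by (simp add: percolates_def far_iff_path filter_empty_conv)

lemma far_tri_edges: "far {e \<in> tri_edges n. P e} c n (0, 0) \<longleftrightarrow> far {e. P e} c n (0, 0)"
proof -
  have eq: "{e \<in> tri_edges n. P e} = {e. P e} \<inter> tri_edges n" by auto
  show ?thesis unfolding eq by (rule far_Int) (auto simp: tri_def lev_def)
qed

lemma perc_space_far:
  assumes "0 \<le> p" "p \<le> 1"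
  shows "{\<omega> \<in> space (perc_space p). far {e. \<omega> e} 0 n (0, 0)} \<in> sets (perc_space p)"
    and "measure (perc_space p) {\<omega> \<in> space (perc_space p). far {e. \<omega> e} 0 n (0, 0)}
       = far_prob p n 0"
proof -
  have eq: "{\<omega> \<in> space (perc_space p). far {e. \<omega> e} 0 n (0, 0)}
      = {\<omega> \<in> space (perc_space p). far {e \<in> tri_edges n. \<omega> e \<in> {True}} 0 n (0, 0)}"
    by (subst far_tri_edges) simp
  have p: "measure (measure_pmf (bernoulli_pmf p)) {True} = p"
    using assms by (simp add: measure_pmf_single)
  note * = measure_PiM_finite_pattern[where M = "measure_pmf (bernoulli_pmf p)" and B = "{True}"
      and E = "tri_edges n" and Q = "\<lambda>A. far A 0 n (0, 0)", folded perc_space_def, unfolded p]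
  show "{\<omega> \<in> space (perc_space p). far {e. \<omega> e} 0 n (0, 0)} \<in> sets (perc_space p)"
    unfolding eq by (rule *(1)) (simp_all add: prob_space_measure_pmf)
  show "measure (perc_space p) {\<omega> \<in> space (perc_space p). far {e. \<omega> e} 0 n (0, 0)}
       = far_prob p n 0"
    unfolding eq far_prob_def by (rule *(2)) (simp_all add: prob_space_measure_pmf)
qed

text \<open>Percolation is the intersection of the decreasing events of reaching level
  \<open>n\<close>, so continuity from above applies.\<close>

lemma perc_prob_ge:
  assumes "0 \<le> p" "p \<le> 1" "\<And>n. c \<le> far_prob p n 0"
  shows "c \<le> perc_prob p"
proof -
  interpret P: prob_space "perc_space p"
    unfolding perc_space_def by (intro prob_space_PiM prob_space_measure_pmf)
  define X where "X n = {\<omega> \<in> space (perc_space p). far {e. \<omega> e} 0 n (0, 0)}" for n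
  have "range X \<subseteq> sets (perc_space p)"
    using perc_space_far(1)[OF assms(1,2)] by (auto simp: X_def)
  moreover have "decseq X"
    unfolding decseq_def X_def using far_mono_length by blast
  ultimately have "(\<lambda>n. P.prob (X n)) \<longlonglongrightarrow> P.prob (\<Inter>n. X n)"
    by (rule P.finite_Lim_measure_decseq)
  then have "c \<le> P.prob (\<Inter>n. X n)"
    by (rule LIMSEQ_le_const) (use perc_space_far(2) assms in \<open>auto simp: X_def\<close>)
  also have "(\<Inter>n. X n) = {\<omega> \<in> space (perc_space p). percolates \<omega>}"
    by (auto simp: X_def percolates_iff_far)
  finally show ?thesis by (simp add: perc_prob_def)
qed

text \<open>This makes the set in the definition of \<open>oriented_pc\<close> nonempty.\<close>

lemma perc_prob_0: "perc_prob 0 = 0"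
proof -
  interpret P: prob_space "perc_space 0"
    unfolding perc_space_def by (intro prob_space_PiM prob_space_measure_pmf)
  have "perc_prob 0 \<le> P.prob {\<omega> \<in> space (perc_space 0). far {e. \<omega> e} 0 1 (0, 0)}"
    unfolding perc_prob_def using perc_space_far(1)[of 0 1]
    by (intro P.finite_measure_mono) (auto simp: percolates_iff_far simp del: far.simps)
  also have "\<dots> = far_prob 0 1 0" by (rule perc_space_far(2)) simp_all
  also have "far_prob 0 1 0 = 0"
    by (simp add: far_prob_def bern_exp_zero)
  finally show ?thesis
    by (simp add: perc_prob_def measure_le_0_iff)
qed

section \<open>Exponential decay below criticality\<close>

text \<open>Otherwise \<open>far_prob p n 0\<close> would be at least
  \<open>1 - exp (q - p)\<close>, a positive number independent of \<open>n\<close>, and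
  \<open>p\<close> would percolate.\<close>

lemma subcritical_exit_mass:
  assumes "0 \<le> q" "q < p" "p \<le> 1" "perc_prob p = 0"
  obtains n S where "S \<subseteq> tri n" "(0, 0) \<in> S" "exit_mass q S < 1"
proof (rule ccontr)
  assume *: "\<not> thesis"
  have "1 - exp (q - p) \<le> far_prob p n 0" for n
    using assms * that by (intro far_prob_lower_bound) (auto simp: not_less[symmetric])
  then have "1 - exp (q - p) \<le> perc_prob p"
    using assms by (intro perc_prob_ge) auto
  then show False using assms by simp
qed

lemma far_prob_antimono:
  assumes "0 \<le> p" "p \<le> 1" "m \<le> n"
  shows "far_prob p n c \<le> far_prob p m c"
proof -
  have "far_prob p n c \<le> bern_exp p (tri_edges n) (\<lambda>A. of_bool (far A c m (0, 0)))"
    unfolding far_prob_def using assms far_mono_length[OF _ assms(3)]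
    by (intro bern_exp_mono) auto
  also have "\<dots> = far_prob p m c"
    using assms by (intro far_prob_translate) (auto simp: lev_def)
  finally show ?thesis .
qed

lemma subcritical_far_prob:
  assumes "0 \<le> q" "q < p" "p \<le> 1" "perc_prob p = 0"
  obtains n \<rho> K where "0 < n" "0 < \<rho>" "\<rho> < 1" "1 < K"
    "\<And>N c. far_prob q N c \<le> \<rho> ^ (N div n) * K ^ c"
proof -
  obtain n S where S: "S \<subseteq> tri n" "(0, 0) \<in> S" "exit_mass q S < 1"
    using subcritical_exit_mass[OF assms] .
  let ?m = "exit_mass q S" and ?D = "real (card (exit_edges S))"
  \<comment> \<open>\<open>K\<close> makes the budget term at most half of the gap
    \<open>1 - ?m\<close>, so that \<open>\<rho>\<close>, the midpoint of \<open>?m\<close> and 1,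
    bounds the sum.\<close>
  define K where "K = 2 + 2 * ?D / (1 - ?m)"
  define \<rho> where "\<rho> = (1 + ?m) / 2"
  have m: "0 \<le> ?m"
    unfolding exit_mass_def using assms by (intro sum_nonneg bern_exp_nonneg) auto
  have K: "1 < K" using S(3) by (simp add: K_def add_pos_nonneg)
  have "(1 - ?m) / 2 * K = (1 - ?m) + ?D"
    using S(3) by (simp add: K_def distrib_left)
  then have "?D \<le> (1 - ?m) / 2 * K" using S(3) by simp
  then have "?D / K \<le> (1 - ?m) / 2"
    using K by (subst pos_divide_le_eq) simp_all
  then have "?m + ?D / K \<le> \<rho>" by (simp add: \<rho>_def field_simps)
  then have decay: "far_prob q (k * n) c \<le> \<rho> ^ k * K ^ c" for k c
    using far_prob_decay[OF S(1,2)] K assms by simp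
  show thesis
  proof
    show "0 < n" using S by (auto simp: tri_def lev_def)
    show "0 < \<rho>" "\<rho> < 1" "1 < K" using m K S(3) by (simp_all add: \<rho>_def)
    show "far_prob q N c \<le> \<rho> ^ (N div n) * K ^ c" for N c
      using far_prob_antimono[of q "N div n * n" N c] decay[of "N div n" c] assms by simp
  qed
qed

section \<open>From small passage times to paths with few slow edges\<close>

lemma lev_endpoint: "lev (endpoint u ss) = lev u + int (length ss)"
  by (induction ss arbitrary: u) auto

lemma path_edges_tri: "e \<in> set (path_edges u ss) \<Longrightarrow>
    fst u \<le> fst (fst e) \<and> snd u \<le> snd (fst e) \<and> lev (fst e) < lev u + int (length ss)"
proof (induction ss arbitrary: u)
  case (Cons d ss)
  show ?case
  proof (cases "e = (u, d)")
    case False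
    then have "e \<in> set (path_edges (step u d) ss)" using Cons.prems by simp
    from Cons.IH[OF this] show ?thesis using step_ge[of u d] by auto
  qed simp
qed simp

lemma endpoint_surj:
  assumes "0 \<le> fst v" "0 \<le> snd v"
  shows "\<exists>ss. endpoint (0, 0) ss = v"
proof -
  have 1: "endpoint u (replicate m False) = (fst u, snd u + int m)" for u m
    by (induction m arbitrary: u) (simp_all add: step_def)
  have "endpoint u (replicate k True @ replicate m False) = (fst u + int k, snd u + int m)" for u k m
    by (induction k arbitrary: u) (simp_all add: step_def 1)
  from this[of "(0, 0)" "nat (fst v)" "nat (snd v)"] assms show ?thesis
    by (auto simp del: replicate_append_same)
qed

text \<open>All NE paths from the origin to \<open>v\<close> have length \<open>lev v\<close>, so
  the infimum runs over a finite nonempty set.\<close>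

lemma dir_T_attained:
  assumes "0 \<le> fst v" "0 \<le> snd v"
  obtains ss where "endpoint (0, 0) ss = v" "dir_T \<omega> (0, 0) v = path_time \<omega> (0, 0) ss"
proof -
  let ?P = "{ss. endpoint (0, 0) ss = v}"
  have "?P \<subseteq> {ss. set ss \<subseteq> UNIV \<and> length ss = nat (lev v)}"
    using lev_endpoint[of "(0, 0)"] by (auto simp: lev_def)
  then have "finite ?P"
    by (rule finite_subset) (rule finite_lists_length_eq, simp)
  moreover have "?P \<noteq> {}" using endpoint_surj[OF assms] by blast
  ultimately have "dir_T \<omega> (0, 0) v \<in> path_time \<omega> (0, 0) ` ?P"
    unfolding dir_T_def by (simp add: cInf_eq_Min)
  then show thesis using that by auto
qed

lemma slow_edges_sum_list:
  fixes \<omega> :: "'a \<Rightarrow> real"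
  assumes "\<And>e. e \<in> set es \<Longrightarrow> 0 \<le> \<omega> e"
  shows "\<epsilon> * real (length (filter (\<lambda>e. e \<notin> {e. \<omega> e \<le> \<epsilon>}) es)) \<le> (\<Sum>e\<leftarrow>es. \<omega> e)"
  using assms
proof (induction es)
  case (Cons a es)
  have "0 \<le> \<omega> a" using Cons.prems by simp
  moreover have "\<epsilon> * real (length (filter (\<lambda>e. e \<notin> {e. \<omega> e \<le> \<epsilon>}) es)) \<le> (\<Sum>e\<leftarrow>es. \<omega> e)"
    using Cons.prems by (intro Cons.IH) simp
  ultimately show ?case
    by (cases "\<omega> a \<le> \<epsilon>") (simp_all add: distrib_left)
qed simp

text \<open>Every edge slower than \<open>\<epsilon>\<close> contributes at least
  \<open>\<epsilon>\<close>, so an optimal path has at most \<open>t / \<epsilon>\<close> of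
  them.\<close>

lemma dir_T_le_imp_far:
  assumes "0 \<le> fst v" "0 \<le> snd v" "0 < \<epsilon>" "dir_T \<omega> (0, 0) v \<le> t"
    "\<And>e. e \<in> tri_edges (nat (lev v)) \<Longrightarrow> 0 \<le> \<omega> e"
  shows "far {e. \<omega> e \<le> \<epsilon>} (nat \<lfloor>t / \<epsilon>\<rfloor>) (nat (lev v)) (0, 0)"
proof -
  obtain ss where ss: "endpoint (0, 0) ss = v" "path_time \<omega> (0, 0) ss \<le> t"
    using dir_T_attained[OF assms(1,2), of \<omega>] assms(4) by metis
  have len: "length ss = nat (lev v)"
    using lev_endpoint[of "(0, 0)" ss] ss(1) by (simp add: lev_def)
  let ?k = "length (filter (\<lambda>e. e \<notin> {e. \<omega> e \<le> \<epsilon>}) (path_edges (0, 0) ss))"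
  have "e \<in> tri_edges (nat (lev v))" if "e \<in> set (path_edges (0, 0) ss)" for e
    using path_edges_tri[OF that] len by (cases e) (auto simp: tri_def lev_def)
  then have "\<epsilon> * real ?k \<le> t"
    using slow_edges_sum_list[of "path_edges (0, 0) ss" \<omega> \<epsilon>] assms(5) ss(2)
    by (force simp: path_time_def)
  then have "real ?k \<le> t / \<epsilon>" using assms(3) by (simp add: field_simps)
  then have "?k \<le> nat \<lfloor>t / \<epsilon>\<rfloor>" by linarith
  then show ?thesis unfolding far_iff_path using len by blast
qed

text \<open>Outside the event \<open>?neg\<close> of a negative time among the finitely many
  relevant edges, \<open>dir_T_le_imp_far\<close> applies. The event \<open>?neg\<close> is null, as
  negative times have density 0.\<close>

lemma dir_T_prob_le:
  assumes F: "prob_space F" "sets F = sets borel" "measure F {..<0} = 0"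
    and "0 \<le> fst v" "0 \<le> snd v" "0 < \<epsilon>"
  shows "measure (fpp_space F) {\<omega> \<in> space (fpp_space F). dir_T \<omega> (0, 0) v \<le> t}
      \<le> far_prob (measure F {..\<epsilon>}) (nat (lev v)) (nat \<lfloor>t / \<epsilon>\<rfloor>)"
proof -
  interpret P: prob_space "fpp_space F"
    unfolding fpp_space_def using F(1) by (intro prob_space_PiM)
  let ?N = "nat (lev v)" and ?c = "nat \<lfloor>t / \<epsilon>\<rfloor>"
  let ?far = "{\<omega> \<in> space (fpp_space F). far {e \<in> tri_edges ?N. \<omega> e \<in> {..\<epsilon>}} ?c ?N (0, 0)}"
  let ?neg = "{\<omega> \<in> space (fpp_space F). {e \<in> tri_edges ?N. \<omega> e \<in> {..<0}} \<noteq> {}}"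
  note pattern = measure_PiM_finite_pattern[OF F(1), where E = "tri_edges ?N", folded fpp_space_def]
  have "{..\<epsilon>} \<in> sets F" "{..<0} \<in> sets F" using F(2) by simp_all
  note far = pattern[OF this(1), where Q = "\<lambda>A. far A ?c ?N (0, 0)"]
    and neg = pattern[OF this(2), where Q = "\<lambda>A. A \<noteq> {}"]
  have "measure (fpp_space F) {\<omega> \<in> space (fpp_space F). dir_T \<omega> (0, 0) v \<le> t}
      \<le> P.prob (?far \<union> ?neg)"
  proof (rule P.finite_measure_mono)
    show "{\<omega> \<in> space (fpp_space F). dir_T \<omega> (0, 0) v \<le> t} \<subseteq> ?far \<union> ?neg"
    proof
      fix \<omega> assume \<omega>: "\<omega> \<in> {\<omega> \<in> space (fpp_space F). dir_T \<omega> (0, 0) v \<le> t}"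
      show "\<omega> \<in> ?far \<union> ?neg"
      proof (cases "\<omega> \<in> ?neg")
        case False
        then have "0 \<le> \<omega> e" if "e \<in> tri_edges ?N" for e
          using \<omega> that by (fastforce simp: not_less)
        with \<omega> have "far {e. \<omega> e \<le> \<epsilon>} ?c ?N (0, 0)"
          using assms(4-6) by (intro dir_T_le_imp_far) auto
        then show ?thesis using \<omega> by (simp only: far_tri_edges) auto
      qed blast
    qed
  qed (use far(1) neg(1) in auto)
  also have "\<dots> \<le> P.prob ?far + P.prob ?neg"
    using far(1) neg(1) by (intro measure_Un_le) auto
  also have "\<dots> = far_prob (measure F {..\<epsilon>}) ?N ?c"
    using far(2) neg(2) F(3) by (simp add: far_prob_def bern_exp_zero)
  finally show ?thesis .
qed

section \<open>The target vertex, the choice of the threshold and the final estimate\<close>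

text \<open>In the first quadrant the sum of cosine and sine is at least the sum of their squares,
  which is 1; each of the two roundings loses at most 1/2.\<close>

lemma nearest_vertex_polar:
  assumes "0 < r" "\<theta> \<in> {0..pi/2}"
  defines "v \<equiv> nearest_vertex (polar r \<theta>)"
  shows "0 \<le> fst v" "0 \<le> snd v" "r - 1 \<le> real (nat (lev v))"
proof -
  have c: "0 \<le> cos \<theta>" and s: "0 \<le> sin \<theta>"
    using assms(2) cos_ge_zero[of \<theta>] sin_ge_zero[of \<theta>] pi_gt_zero by simp_all
  show v: "0 \<le> fst v" "0 \<le> snd v"
    using round_mono[of 0 "r * cos \<theta>"] round_mono[of 0 "r * sin \<theta>"] c s assms(1)
    by (simp_all add: v_def nearest_vertex_def polar_def)
  have "(cos \<theta>)\<^sup>2 + (sin \<theta>)\<^sup>2 \<le> cos \<theta> + sin \<theta>"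
    using c s by (intro add_mono) (simp_all add: power2_eq_square mult_left_le)
  then have "r * 1 \<le> r * (cos \<theta> + sin \<theta>)"
    using assms(1) by (intro mult_left_mono) auto
  then have "r - 1 \<le> (r * cos \<theta> - 1 / 2) + (r * sin \<theta> - 1 / 2)"
    by (simp add: algebra_simps)
  also have "\<dots> \<le> of_int (fst v) + of_int (snd v)"
    unfolding v_def nearest_vertex_def polar_def fst_conv snd_conv
    by (intro add_mono of_int_round_ge)
  finally show "r - 1 \<le> real (nat (lev v))" using v by (simp add: lev_def)
qed

lemma oriented_pc_less:
  assumes "x < oriented_pc"
  obtains p where "0 \<le> p" "p \<le> 1" "perc_prob p = 0" "x < p"
proof -
  have "{p \<in> {0..1}. perc_prob p = 0} \<noteq> {}"
    using perc_prob_0 by (auto intro!: exI[of _ 0])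
  from less_cSupE[OF assms[unfolded oriented_pc_def] this] show thesis
    using that by auto
qed

text \<open>Without negative mass the distribution function at 0 equals the atom there, and it is
  right continuous.\<close>

lemma measure_atMost_less:
  assumes "prob_space F" "sets F = sets borel" "measure F {..<0::real} = 0" "measure F {0} < p"
  obtains \<epsilon> where "0 < \<epsilon>" "measure F {..\<epsilon>} < p"
proof -
  interpret F: real_distribution F
    using assms(1,2) by (simp add: real_distribution_def real_distribution_axioms_def)
  have "measure F {..0} \<le> measure F {..<0} + measure F {0}"
  proof -
    have "{..0::real} = {..<0} \<union> {0}" by auto
    then show ?thesis
      using measure_Un_le[of "{..<0}" F "{0}"] assms(2) by simp
  qed
  then have "cdf F 0 < p" using assms(3,4) by (simp add: cdf_def)
  moreover have "(cdf F \<longlongrightarrow> cdf F 0) (at_right 0)"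
    using F.cdf_is_right_cont[of 0] by (simp add: continuous_within)
  ultimately have "eventually (\<lambda>\<epsilon>. cdf F \<epsilon> < p) (at_right 0)"
    by (rule order_tendstoD(2)[rotated])
  then obtain b where "0 < b" "\<And>\<epsilon>. 0 < \<epsilon> \<Longrightarrow> \<epsilon> < b \<Longrightarrow> cdf F \<epsilon> < p"
    by (auto simp: eventually_at_right_field)
  then show thesis using that[of "b / 2"] by (simp add: cdf_def)
qed

theorem theorem8:
  fixes F :: "real measure"
  assumes "prob_space F"
    and "sets F = sets borel"
    and "measure F {..<0} = 0"
    and "measure F {0} < oriented_pc"
  shows "\<exists>\<delta>>0. \<exists>C1>0. \<exists>C2>0. \<forall>r>0. \<forall>\<theta>\<in>{0..pi/2}.
           measure (fpp_space F)
             {\<omega>\<in>space (fpp_space F). dir_T \<omega> (0,0) (nearest_vertex (polar r \<theta>)) \<le> \<delta> * r}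
           \<le> C1 * exp (- C2 * r)"
proof -
  obtain p where p: "0 \<le> p" "p \<le> 1" "perc_prob p = 0" "measure F {0} < p"
    using oriented_pc_less[OF assms(4)] .
  obtain \<epsilon> where \<epsilon>: "0 < \<epsilon>" "measure F {..\<epsilon>} < p"
    using measure_atMost_less[OF assms(1-3) p(4)] .
  obtain n \<rho> K where n: "0 < n" and \<rho>: "0 < \<rho>" "\<rho> < 1" and K: "1 < K"
    and decay: "\<And>N c. far_prob (measure F {..\<epsilon>}) N c \<le> \<rho> ^ (N div n) * K ^ c"
    using subcritical_far_prob[OF measure_nonneg \<epsilon>(2) p(2,3)] by metis
  \<comment> \<open>The bound will be \<open>exp (- a * (N div n) + b * c)\<close> with
    \<open>N\<close> at least \<open>r - 1\<close> and \<open>c\<close> at most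
    \<open>\<delta> * r / \<epsilon>\<close>. This \<open>\<delta>\<close> lets the budget term
    consume exactly half of the decay rate \<open>a / n\<close>.\<close>
  define a where "a = - ln \<rho>"
  define b where "b = ln K"
  define \<delta> where "\<delta> = \<epsilon> * a / (2 * n * b)"
  have ab: "0 < a" "0 < b" using \<rho> K by (simp_all add: a_def b_def)
  show ?thesis
  proof (intro exI conjI allI ballI impI)
    show "0 < \<delta>" "0 < exp (2 * a)" "0 < a / (2 * n)"
      using ab \<epsilon> n by (simp_all add: \<delta>_def)
    fix r \<theta> :: real
    assume r: "0 < r" and \<theta>: "\<theta> \<in> {0..pi/2}"
    let ?v = "nearest_vertex (polar r \<theta>)"
    let ?N = "nat (lev ?v)" and ?c = "nat \<lfloor>\<delta> * r / \<epsilon>\<rfloor>"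
    note v = nearest_vertex_polar[OF r \<theta>]
    \<comment> \<open>One unit is lost to integer division, and at most one to the
      \<open>r - 1\<close> of the rounding since \<open>n\<close> is at least 1; the total of 2
      turns into the constant \<open>exp (2 * a)\<close>.\<close>
    have k: "r / n - 2 \<le> real (?N div n)"
    proof -
      have "?N = ?N div n * n + ?N mod n" by simp
      also have "\<dots> \<le> ?N div n * n + n"
        using n by (intro add_left_mono less_imp_le mod_less_divisor)
      finally have "real ?N \<le> real (?N div n) * n + n"
        by (metis of_nat_add of_nat_le_iff of_nat_mult)
      then have "r \<le> (real (?N div n) + 2) * n" using v(3) n by (simp add: algebra_simps)
      then show ?thesis using n by (simp add: field_simps)
    qed
    have c: "real ?c \<le> \<delta> * r / \<epsilon>"
      using r \<epsilon> \<open>0 < \<delta>\<close> by simp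
    have "measure (fpp_space F) {\<omega>\<in>space (fpp_space F). dir_T \<omega> (0,0) ?v \<le> \<delta> * r}
        \<le> \<rho> ^ (?N div n) * K ^ ?c"
      using dir_T_prob_le[OF assms(1-3) v(1,2) \<epsilon>(1), of "\<delta> * r"] decay by (rule order_trans)
    also have "\<dots> = exp (- a * real (?N div n) + b * real ?c)"
      using \<rho> K by (simp add: a_def b_def exp_add exp_of_nat2_mult)
    also have "\<dots> \<le> exp (- a * (r / n - 2) + b * (\<delta> * r / \<epsilon>))"
      using k c ab by (intro exp_mono add_mono mult_left_mono mult_left_mono_neg) auto
    also have "- a * (r / n - 2) + b * (\<delta> * r / \<epsilon>) = 2 * a - a / (2 * n) * r"
      using ab \<epsilon> n by (simp add: \<delta>_def field_simps)
    also have "exp \<dots> = exp (2 * a) * exp (- (a / (2 * n)) * r)"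
      by (simp add: exp_add[symmetric])
    finally show "measure (fpp_space F) {\<omega>\<in>space (fpp_space F). dir_T \<omega> (0,0) ?v \<le> \<delta> * r}
        \<le> exp (2 * a) * exp (- (a / (2 * n)) * r)" .
  qed
qed

end
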